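(* Let $n\geq 2$ be an integer and let $(X,\|\cdot\|_X)$ be a nonzero real Banach space. Then the following conditions are equivalent: (a) $\overline{C}_{mNJ}^{(n)}(X)<n$. (b) $X$ is uniformly non-$l_n^1$. (c) There exists $\delta\in(0,1)$ such that for every $(x_1,\dots,x_n)\in B(l_n^2(X))$, $$\min_{\theta_j=\pm1}\Big\|x_1+\sum_{j=2}^n\theta_jx_j\Big\|_X\leq\sqrt{n}\,(1-\delta).$$ (d) There exists $\delta\in(0,1)$ such that for every $(x_1,\dots,x_n)\in S(l_n^2(X))$, $$\min_{\theta_j=\pm1}\Big\|x_1+\sum_{j=2}^n\theta_jx_j\Big\|_X\leq\sqrt{n}\,(1-\delta).$$
   Context: For a real Banach space $Y$, $B(Y)$ is its closed unit ball and $S(Y)$ its unit sphere. $l_n^2(X)$ is $X^n$ with norm $\|(x_1,\dots,x_n)\|=\big(\sum_{j=1}^n\|x_j\|_X^2\big)^{1/2}$. Minima and sums "over $\theta_j=\pm1$" are taken over all $(\theta_2,\dots,\theta_n)\in\{-1,1\}^{n-1}$. For $x_1,\dots,x_n\in X$ with $\sum_{j=1}^n\|x_j\|_X^2>0$ put $$C^{(n)}(x_1,\dots,x_n)=\frac{\sum_{\theta_j=\pm1}\|x_1+\sum_{j=2}^n\theta_jx_j\|_X^2}{2^{n-1}\sum_{j=1}^n\|x_j\|_X^2}.$$ The upper modified $n$-th von Neumann-Jordan constant is $\overline{C}_{mNJ}^{(n)}(X)=\sup\{C^{(n)}(x_1,\dots,x_n):x_1,\dots,x_n\in S(X)\}$.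 $X$ is uniformly non-$l_n^1$ if there exists $\delta>0$ such that for all $x_1,\dots,x_n\in B(X)$, $\min_{\theta_j=\pm1}\|x_1+\sum_{j=2}^n\theta_jx_j\|_X\leq n(1-\delta)$. *)

theory Defs
  imports "HOL-Analysis.Analysis"
begin

(* A real Banach space X is a type of class banach.  An n-tuple (x_1,...,x_n) over X is a function
   in {1..n} \<rightarrow>\<^sub>E UNIV, i.e. it takes the junk value undefined outside {1..n}; likewise a choice of
   signs (theta_2,...,theta_n) is an element of {2..n} \<rightarrow>\<^sub>E {-1, 1}, so that there are exactly
   2^(n-1) of them. *)

definition sign_choices :: "nat \<Rightarrow> (nat \<Rightarrow> real) set" where
  "sign_choices n = ({2..n} \<rightarrow>\<^sub>E {-1, 1})"

definition signed_sum :: "nat \<Rightarrow> (nat \<Rightarrow> 'a::real_normed_vector) \<Rightarrow> (nat \<Rightarrow> real) \<Rightarrow> 'a" where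
  "signed_sum n x \<theta> = x 1 + (\<Sum>j=2..n. \<theta> j *\<^sub>R x j)"

definition min_signed_norm :: "nat \<Rightarrow> (nat \<Rightarrow> 'a::real_normed_vector) \<Rightarrow> real" where
  "min_signed_norm n x = Min ((\<lambda>\<theta>. norm (signed_sum n x \<theta>)) ` sign_choices n)"

(* Only meaningful if the x_j are not all zero; otherwise the value is 0 by division by zero. *)
definition vNJ_quotient :: "nat \<Rightarrow> (nat \<Rightarrow> 'a::real_normed_vector) \<Rightarrow> real" where
  "vNJ_quotient n x =
     (\<Sum>\<theta>\<in>sign_choices n. (norm (signed_sum n x \<theta>))\<^sup>2) / (2 ^ (n - 1) * (\<Sum>j=1..n. (norm (x j))\<^sup>2))"

(* A supremum in the reals: for n \<ge> 1 and a nonzero space, the set is nonempty and, by the triangle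
   inequality, bounded above by n. *)
definition upper_mNJ_const :: "nat \<Rightarrow> 'a::real_normed_vector itself \<Rightarrow> real" where
  "upper_mNJ_const n (_ :: 'a itself) =
     (SUP x \<in> {1..n} \<rightarrow>\<^sub>E sphere (0::'a) 1. vNJ_quotient n x)"

definition uniformly_non_l1n :: "nat \<Rightarrow> 'a::real_normed_vector itself \<Rightarrow> bool" where
  "uniformly_non_l1n n (_ :: 'a itself) \<longleftrightarrow>
     (\<exists>\<delta>>0. \<forall>x \<in> {1..n} \<rightarrow>\<^sub>E cball (0::'a) 1. min_signed_norm n x \<le> real n * (1 - \<delta>))"

definition l2n_norm :: "nat \<Rightarrow> (nat \<Rightarrow> 'a::real_normed_vector) \<Rightarrow> real" where
  "l2n_norm n x = L2_set (\<lambda>j. norm (x j)) {1..n}"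

definition l2n_unit_ball :: "nat \<Rightarrow> (nat \<Rightarrow> 'a::real_normed_vector) set" where
  "l2n_unit_ball n = {x \<in> {1..n} \<rightarrow>\<^sub>E UNIV. l2n_norm n x \<le> 1}"

definition l2n_unit_sphere :: "nat \<Rightarrow> (nat \<Rightarrow> 'a::real_normed_vector) set" where
  "l2n_unit_sphere n = {x \<in> {1..n} \<rightarrow>\<^sub>E UNIV. l2n_norm n x = 1}"

end

theory Submission
  imports Defs
begin

text \<open>
  All the conditions say that, in a quantitative sense, no \<open>n\<close> vectors behave like the unit vector
  basis of \<open>l\<^sub>1\<close>, and the proof compares each of them with the version of the uniform
  non-\<open>l\<^sub>n\<^sup>1\<close> condition in which the vectors have norm exactly one
  (\<open>non_l1n_on_sphere\<close> below).

  For unit vectors, the quotient in the von Neumann-Jordan constant is the mean of the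
  \<open>2 ^ (n - 1)\<close> squared norms of the signed sums, divided by \<open>n\<close>. Each norm is at most \<open>n\<close>, so the
  mean is close to \<open>n\<^sup>2\<close> exactly if even the smallest norm is close to \<open>n\<close>. As the number of sign
  choices is a constant, this is uniform in the vectors.

  To pass from arbitrary vectors to unit vectors, replace each \<open>x\<^sub>j\<close> by a unit vector \<open>y\<^sub>j\<close> in its
  direction. By \<open>normalize_tuple\<close>, for each \<open>c \<ge> 0\<close>, the minimal norm for \<open>x\<close> exceeds \<open>c\<close> times the
  one for \<open>y\<close> by at most \<open>\<Sum>j. \<bar>\<parallel>x\<^sub>j\<parallel> - c\<bar>\<close>. This error is controlled by the minimal norm for \<open>x\<close>
  itself, which is a lower bound for \<open>\<Sum>j. \<parallel>x\<^sub>j\<parallel>\<close>: if it is nearly as large as the constraint on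
  \<open>x\<close> permits, then all \<open>\<parallel>x\<^sub>j\<parallel>\<close> are close to \<open>c\<close>. Here \<open>c = 1\<close> for vectors in the unit
  ball, and \<open>c = 1 / sqrt n\<close> for tuples in the ball of \<open>l\<^sub>n\<^sup>2\<close>, where closeness comes from the
  equality case of the Cauchy-Schwarz inequality. In the other direction, a tuple of unit vectors
  divided by \<open>sqrt n\<close> lies on the sphere of \<open>l\<^sub>n\<^sup>2\<close>.
\<close>

section \<open>Signed sums and their minimal norm\<close>

lemma finite_sign_choices: "finite (sign_choices n)"
  unfolding sign_choices_def by (intro finite_PiE) auto

lemma card_sign_choices: "card (sign_choices n) = 2 ^ (n - 1)"
  unfolding sign_choices_def by (subst card_PiE) (auto simp: numeral_2_eq_2)

lemma sign_choices_nonempty: "sign_choices n \<noteq> {}"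
  unfolding sign_choices_def by (auto simp: PiE_eq_empty_iff)

lemma min_signed_norm_le:
  "\<theta> \<in> sign_choices n \<Longrightarrow> min_signed_norm n x \<le> norm (signed_sum n x \<theta>)"
  unfolding min_signed_norm_def by (intro Min_le) (auto simp: finite_sign_choices)

lemma min_signed_norm_attained:
  obtains \<theta> where "\<theta> \<in> sign_choices n" "min_signed_norm n x = norm (signed_sum n x \<theta>)"
proof -
  have "min_signed_norm n x \<in> (\<lambda>\<theta>. norm (signed_sum n x \<theta>)) ` sign_choices n"
    unfolding min_signed_norm_def
    by (intro Min_in) (auto simp: finite_sign_choices sign_choices_nonempty)
  then show ?thesis using that by auto
qed

lemma min_signed_norm_nonneg: "0 \<le> min_signed_norm n x"
  by (metis min_signed_norm_attained norm_ge_zero)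

lemma signed_sum_diff:
  "signed_sum n (\<lambda>j. x j - y j) \<theta> = signed_sum n x \<theta> - signed_sum n y \<theta>"
  unfolding signed_sum_def by (simp add: scaleR_diff_right sum_subtractf)

lemma signed_sum_scaleR:
  "signed_sum n (\<lambda>j. c *\<^sub>R x j) \<theta> = c *\<^sub>R signed_sum n x \<theta>"
  unfolding signed_sum_def by (simp add: scaleR_add_right scaleR_sum_right mult.commute)

lemma signed_sum_cong:
  assumes "n \<ge> 1" and "\<And>j. j \<in> {1..n} \<Longrightarrow> x j = y j"
  shows "signed_sum n x \<theta> = signed_sum n y \<theta>"
  unfolding signed_sum_def using assms by (auto intro!: sum.cong)

lemma min_signed_norm_cong:
  assumes "n \<ge> 1" and "\<And>j. j \<in> {1..n} \<Longrightarrow> x j = y j"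
  shows "min_signed_norm n x = min_signed_norm n y"
  unfolding min_signed_norm_def using signed_sum_cong[OF assms] by simp

lemma norm_signed_sum_le:
  assumes "n \<ge> 1" and "\<theta> \<in> sign_choices n"
  shows "norm (signed_sum n x \<theta>) \<le> (\<Sum>j=1..n. norm (x j))"
proof -
  have sgn: "\<bar>\<theta> j\<bar> = 1" if "j \<in> {2..n}" for j
    using PiE_mem[OF assms(2)[unfolded sign_choices_def] that] by auto
  have "norm (signed_sum n x \<theta>) \<le> norm (x 1) + (\<Sum>j=2..n. norm (\<theta> j *\<^sub>R x j))"
    unfolding signed_sum_def by (intro order_trans[OF norm_triangle_ineq] add_left_mono norm_sum)
  also have "(\<Sum>j=2..n. norm (\<theta> j *\<^sub>R x j)) = (\<Sum>j=2..n. norm (x j))"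
    using sgn by (intro sum.cong) auto
  also have "norm (x 1) + \<dots> = (\<Sum>j=1..n. norm (x j))"
    using sum.atLeast_Suc_atMost[of 1 n "\<lambda>j. norm (x j)"] assms(1)
    by (simp add: numeral_2_eq_2)
  finally show ?thesis .
qed

lemma min_signed_norm_le_sum_norm:
  assumes "n \<ge> 1"
  shows "min_signed_norm n x \<le> (\<Sum>j=1..n. norm (x j))"
  using min_signed_norm_attained[of n x] norm_signed_sum_le[OF assms] by metis

lemma min_signed_norm_scaleR:
  assumes "c \<ge> 0"
  shows "min_signed_norm n (\<lambda>j. c *\<^sub>R x j) = c * min_signed_norm n x"
proof (rule antisym)
  obtain \<theta> where "\<theta> \<in> sign_choices n" "min_signed_norm n x = norm (signed_sum n x \<theta>)"
    by (rule min_signed_norm_attained)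
  then show "min_signed_norm n (\<lambda>j. c *\<^sub>R x j) \<le> c * min_signed_norm n x"
    using min_signed_norm_le[of \<theta> n "\<lambda>j. c *\<^sub>R x j"] assms by (simp add: signed_sum_scaleR)
next
  obtain \<theta> where "\<theta> \<in> sign_choices n"
    "min_signed_norm n (\<lambda>j. c *\<^sub>R x j) = norm (signed_sum n (\<lambda>j. c *\<^sub>R x j) \<theta>)"
    by (rule min_signed_norm_attained)
  then show "c * min_signed_norm n x \<le> min_signed_norm n (\<lambda>j. c *\<^sub>R x j)"
    using min_signed_norm_le[of \<theta> n x] assms by (simp add: signed_sum_scaleR mult_left_mono)
qed

lemma min_signed_norm_perturb:
  assumes "n \<ge> 1"
  shows "min_signed_norm n x \<le> min_signed_norm n y + (\<Sum>j=1..n. norm (x j - y j))"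
proof -
  obtain \<theta> where \<theta>: "\<theta> \<in> sign_choices n" "min_signed_norm n y = norm (signed_sum n y \<theta>)"
    by (rule min_signed_norm_attained)
  have "min_signed_norm n x \<le> norm (signed_sum n x \<theta>)"
    using \<theta>(1) by (rule min_signed_norm_le)
  also have "\<dots> \<le> norm (signed_sum n y \<theta>) + norm (signed_sum n x \<theta> - signed_sum n y \<theta>)"
    by (rule norm_triangle_sub)
  also have "norm (signed_sum n x \<theta> - signed_sum n y \<theta>) \<le> (\<Sum>j=1..n. norm (x j - y j))"
    using norm_signed_sum_le[OF assms \<theta>(1), of "\<lambda>j. x j - y j"] by (simp add: signed_sum_diff)
  finally show ?thesis using \<theta>(2) by simp
qed

section \<open>Reduction to unit vectors\<close>

definition non_l1n_on_sphere :: "nat \<Rightarrow> real \<Rightarrow> 'a::real_normed_vector itself \<Rightarrow> bool" where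
  "non_l1n_on_sphere n \<delta> (_ :: 'a itself) \<longleftrightarrow>
     (\<forall>x \<in> {1..n} \<rightarrow>\<^sub>E sphere (0::'a) 1. min_signed_norm n x \<le> real n * (1 - \<delta>))"

text \<open>
  The point of the comparison is that \<open>x\<^sub>j\<close> and \<open>c y\<^sub>j\<close> lie on one ray, so that their distance is
  the difference of their norms. For \<open>x\<^sub>j = 0\<close> every direction has this property.
\<close>

lemma normalize_tuple:
  fixes x :: "nat \<Rightarrow> 'a::real_normed_vector"
  assumes "n \<ge> 1" and "\<exists>v::'a. v \<noteq> 0" and "c \<ge> 0"
  obtains y where "y \<in> {1..n} \<rightarrow>\<^sub>E sphere (0::'a) 1"
    "min_signed_norm n x \<le> c * min_signed_norm n y + (\<Sum>j=1..n. \<bar>norm (x j) - c\<bar>)"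
proof -
  obtain v :: 'a where "v \<noteq> 0" using assms(2) by blast
  define w where "w = (\<lambda>j. if x j = 0 then sgn v else sgn (x j))"
  have unit: "norm (w j) = 1" for j
    using \<open>v \<noteq> 0\<close> by (simp add: w_def norm_sgn)
  have ray: "x j = norm (x j) *\<^sub>R w j" for j
    by (simp add: w_def sgn_div_norm)
  have dist: "norm (x j - c *\<^sub>R w j) = \<bar>norm (x j) - c\<bar>" for j
  proof -
    have "x j - c *\<^sub>R w j = (norm (x j) - c) *\<^sub>R w j"
      using ray[of j] by (simp add: scaleR_diff_left)
    then show ?thesis by (simp add: unit)
  qed
  have "min_signed_norm n (restrict w {1..n}) = min_signed_norm n w"
    using assms(1) by (intro min_signed_norm_cong) auto
  then have "min_signed_norm n x
      \<le> c * min_signed_norm n (restrict w {1..n}) + (\<Sum>j=1..n. \<bar>norm (x j) - c\<bar>)"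
    using min_signed_norm_perturb[OF assms(1), of x "\<lambda>j. c *\<^sub>R w j"]
    by (simp add: min_signed_norm_scaleR[OF assms(3)] dist)
  moreover have "restrict w {1..n} \<in> {1..n} \<rightarrow>\<^sub>E sphere 0 1"
    by (auto simp: unit)
  ultimately show ?thesis by (rule that[rotated])
qed

text \<open>
  In the unit ball the normalization error is \<open>n - (\<Sum>j. \<parallel>x\<^sub>j\<parallel>)\<close>, hence at most \<open>n\<close> minus the minimal
  norm for \<open>x\<close>. Moving the latter to the left-hand side costs a factor of two.
\<close>

lemma uniformly_non_l1n_iff_sphere:
  assumes "n \<ge> 1" and "\<exists>v::'a::real_normed_vector. v \<noteq> 0"
  shows "uniformly_non_l1n n TYPE('a) \<longleftrightarrow> (\<exists>\<delta>>0. non_l1n_on_sphere n \<delta> TYPE('a))"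
proof
  assume "uniformly_non_l1n n TYPE('a)"
  then obtain \<delta> where \<delta>: "\<delta> > 0"
    "\<forall>x \<in> {1..n} \<rightarrow>\<^sub>E cball (0::'a) 1. min_signed_norm n x \<le> real n * (1 - \<delta>)"
    unfolding uniformly_non_l1n_def by blast
  have "({1..n} \<rightarrow>\<^sub>E sphere (0::'a) 1) \<subseteq> ({1..n} \<rightarrow>\<^sub>E cball 0 1)"
    by (intro PiE_mono) auto
  then have "non_l1n_on_sphere n \<delta> TYPE('a)"
    unfolding non_l1n_on_sphere_def using \<delta>(2) by (meson subsetD)
  then show "\<exists>\<delta>>0. non_l1n_on_sphere n \<delta> TYPE('a)"
    using \<delta>(1) by blast
next
  assume "\<exists>\<delta>>0. non_l1n_on_sphere n \<delta> TYPE('a)"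
  then obtain \<delta> where \<delta>: "\<delta> > 0" "non_l1n_on_sphere n \<delta> TYPE('a)" by blast
  have "min_signed_norm n x \<le> real n * (1 - \<delta> / 2)"
    if x: "x \<in> {1..n} \<rightarrow>\<^sub>E cball (0::'a) 1" for x
  proof -
    obtain y where y: "y \<in> {1..n} \<rightarrow>\<^sub>E sphere (0::'a) 1"
      "min_signed_norm n x \<le> 1 * min_signed_norm n y + (\<Sum>j=1..n. \<bar>norm (x j) - 1\<bar>)"
      using normalize_tuple[OF assms, of 1 x] by auto
    have "norm (x j) \<le> 1" if "j \<in> {1..n}" for j
      using PiE_mem[OF x that] by simp
    then have "(\<Sum>j=1..n. \<bar>norm (x j) - 1\<bar>) = (\<Sum>j=1..n. 1 - norm (x j))"
      by (intro sum.cong) auto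
    also have "\<dots> = real n - (\<Sum>j=1..n. norm (x j))"
      by (simp add: sum_subtractf)
    also have "\<dots> \<le> real n - min_signed_norm n x"
      using min_signed_norm_le_sum_norm[OF assms(1)] by simp
    finally have "2 * min_signed_norm n x \<le> min_signed_norm n y + real n"
      using y(2) by simp
    moreover have "min_signed_norm n y \<le> real n * (1 - \<delta>)"
      using \<delta>(2) y(1) unfolding non_l1n_on_sphere_def by blast
    ultimately show ?thesis by (simp add: algebra_simps)
  qed
  then show "uniformly_non_l1n n TYPE('a)"
    unfolding uniformly_non_l1n_def using \<delta>(1) by (intro exI[of _ "\<delta> / 2"]) auto
qed

section \<open>The von Neumann-Jordan constant\<close>

text \<open>
  The upper bound keeps one summand, that of the minimizing signs, and estimates all the others by
  \<open>n\<^sup>2\<close>.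
\<close>

lemma vNJ_quotient_sphere_bounds:
  fixes x :: "nat \<Rightarrow> 'a::real_normed_vector"
  assumes "n \<ge> 1" and x: "x \<in> {1..n} \<rightarrow>\<^sub>E sphere 0 1"
  shows "(min_signed_norm n x)\<^sup>2 / n \<le> vNJ_quotient n x"
    and "vNJ_quotient n x \<le> n - ((real n)\<^sup>2 - (min_signed_norm n x)\<^sup>2) / (2 ^ (n - 1) * real n)"
proof -
  define m where "m = min_signed_norm n x"
  define S where "S = (\<Sum>\<theta>\<in>sign_choices n. (norm (signed_sum n x \<theta>))\<^sup>2)"
  define N :: real where "N = 2 ^ (n - 1)"
  have N: "N > 0" "real (card (sign_choices n)) = N"
    by (simp_all add: N_def card_sign_choices)
  have unit: "norm (x j) = 1" if "j \<in> {1..n}" for j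
    using PiE_mem[OF x that] by simp
  have Q: "vNJ_quotient n x = S / (N * n)"
    unfolding vNJ_quotient_def S_def N_def using unit by simp
  have "N * m\<^sup>2 = (\<Sum>\<theta>\<in>sign_choices n. m\<^sup>2)"
    using N by simp
  also have "\<dots> \<le> S"
    unfolding S_def m_def
    by (intro sum_mono power_mono min_signed_norm_le min_signed_norm_nonneg)
  finally have "N * m\<^sup>2 \<le> S" .
  then show "(min_signed_norm n x)\<^sup>2 / n \<le> vNJ_quotient n x"
    unfolding Q m_def[symmetric] using N(1) assms(1) by (simp add: field_simps)
  have le_n: "norm (signed_sum n x \<theta>) \<le> n" if "\<theta> \<in> sign_choices n" for \<theta>
    using norm_signed_sum_le[OF assms(1) that, of x] unit by simp
  obtain \<theta>\<^sub>0 where \<theta>\<^sub>0: "\<theta>\<^sub>0 \<in> sign_choices n" "m = norm (signed_sum n x \<theta>\<^sub>0)"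
    unfolding m_def by (rule min_signed_norm_attained)
  have "(real n)\<^sup>2 - m\<^sup>2 \<le> (\<Sum>\<theta>\<in>sign_choices n. (real n)\<^sup>2 - (norm (signed_sum n x \<theta>))\<^sup>2)"
    unfolding \<theta>\<^sub>0(2)
    by (rule member_le_sum[OF \<theta>\<^sub>0(1)]) (auto simp: finite_sign_choices le_n power_mono)
  also have "\<dots> = N * (real n)\<^sup>2 - S"
    using N by (simp add: sum_subtractf S_def)
  finally have "S \<le> N * (real n)\<^sup>2 - ((real n)\<^sup>2 - m\<^sup>2)" by simp
  then have "S / (N * n) \<le> (N * (real n)\<^sup>2 - ((real n)\<^sup>2 - m\<^sup>2)) / (N * n)"
    using N(1) by (intro divide_right_mono) auto
  also have "\<dots> = n - ((real n)\<^sup>2 - m\<^sup>2) / (N * n)"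
    using N(1) assms(1) by (simp add: diff_divide_distrib power2_eq_square)
  finally show "vNJ_quotient n x \<le> n - ((real n)\<^sup>2 - (min_signed_norm n x)\<^sup>2) / (2 ^ (n - 1) * real n)"
    unfolding Q m_def N_def .
qed

lemma vNJ_quotient_sphere_le:
  fixes x :: "nat \<Rightarrow> 'a::real_normed_vector"
  assumes "n \<ge> 1" and x: "x \<in> {1..n} \<rightarrow>\<^sub>E sphere 0 1"
  shows "vNJ_quotient n x \<le> n"
proof -
  have "norm (x j) = 1" if "j \<in> {1..n}" for j
    using PiE_mem[OF x that] by simp
  then have "min_signed_norm n x \<le> n"
    using min_signed_norm_le_sum_norm[OF assms(1), of x] by simp
  then have "0 \<le> ((real n)\<^sup>2 - (min_signed_norm n x)\<^sup>2) / (2 ^ (n - 1) * real n)"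
    by (simp add: power_mono min_signed_norm_nonneg)
  then show ?thesis
    using vNJ_quotient_sphere_bounds(2)[OF assms] by linarith
qed

text \<open>
  If \<open>C < n\<close> is the supremum, then the minimal norm is at most \<open>sqrt (n * C) = n * sqrt (C / n)\<close>.
  Conversely, a uniform gap for the minimal norm gives a bound \<open>K < n\<close> for all quotients at once, and
  so the supremum stays away from \<open>n\<close> even if it is not attained.
\<close>

lemma upper_mNJ_const_less_iff_sphere:
  assumes "n \<ge> 1" and "\<exists>v::'a::real_normed_vector. v \<noteq> 0"
  shows "upper_mNJ_const n TYPE('a) < n \<longleftrightarrow> (\<exists>\<delta>>0. non_l1n_on_sphere n \<delta> TYPE('a))"
proof
  define C where "C = upper_mNJ_const n TYPE('a)"
  assume "upper_mNJ_const n TYPE('a) < n"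
  then have "C / n < 1" using assms(1) by (simp add: C_def)
  have "min_signed_norm n x \<le> n * (1 - (1 - sqrt (C / n)))"
    if x: "x \<in> {1..n} \<rightarrow>\<^sub>E sphere (0::'a) 1" for x
  proof -
    have "vNJ_quotient n x \<le> C"
      unfolding C_def upper_mNJ_const_def
      by (intro cSUP_upper[OF x] bdd_aboveI2[where M = "real n"] vNJ_quotient_sphere_le[OF assms(1)])
    then have "(min_signed_norm n x)\<^sup>2 / n \<le> C"
      using vNJ_quotient_sphere_bounds(1)[OF assms(1) x] by linarith
    then have "(min_signed_norm n x)\<^sup>2 \<le> n\<^sup>2 * (C / n)"
      using assms(1) by (simp add: field_simps power2_eq_square)
    then have "min_signed_norm n x \<le> sqrt (n\<^sup>2 * (C / n))"
      by (rule real_le_rsqrt)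
    then show ?thesis by (simp only: real_sqrt_mult) simp
  qed
  then show "\<exists>\<delta>>0. non_l1n_on_sphere n \<delta> TYPE('a)"
    unfolding non_l1n_on_sphere_def using \<open>C / n < 1\<close>
    by (intro exI[of _ "1 - sqrt (C / n)"]) auto
next
  assume "\<exists>\<delta>>0. non_l1n_on_sphere n \<delta> TYPE('a)"
  then obtain \<delta> where \<delta>: "\<delta> > 0" "non_l1n_on_sphere n \<delta> TYPE('a)" by blast
  obtain u where u: "u \<in> {1..n} \<rightarrow>\<^sub>E sphere (0::'a) 1"
    using normalize_tuple[OF assms zero_le_one] by blast
  have m: "min_signed_norm n x \<le> n * (1 - \<delta>)"
    if "x \<in> {1..n} \<rightarrow>\<^sub>E sphere (0::'a) 1" for x
    using \<delta>(2) that unfolding non_l1n_on_sphere_def by blast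
  \<comment> \<open>A tuple of unit vectors exists, which forces \<open>\<delta> \<le> 1\<close>; otherwise squaring would not preserve
    the order.\<close>
  have "0 \<le> n * (1 - \<delta>)"
    using m[OF u] min_signed_norm_nonneg[of n u] by linarith
  moreover have "n * (1 - \<delta>) < n"
    using \<delta>(1) assms(1) by simp
  ultimately have gap: "(n * (1 - \<delta>))\<^sup>2 < (real n)\<^sup>2"
    by (intro power_strict_mono) auto
  define K where "K = n - ((real n)\<^sup>2 - (n * (1 - \<delta>))\<^sup>2) / (2 ^ (n - 1) * real n)"
  have "vNJ_quotient n x \<le> K" if x: "x \<in> {1..n} \<rightarrow>\<^sub>E sphere (0::'a) 1" for x
  proof -
    have "(min_signed_norm n x)\<^sup>2 \<le> (n * (1 - \<delta>))\<^sup>2"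
      using m[OF x] by (simp add: power_mono min_signed_norm_nonneg)
    then have "((real n)\<^sup>2 - (n * (1 - \<delta>))\<^sup>2) / (2 ^ (n - 1) * real n)
        \<le> ((real n)\<^sup>2 - (min_signed_norm n x)\<^sup>2) / (2 ^ (n - 1) * real n)"
      by (intro divide_right_mono) auto
    then show ?thesis
      using vNJ_quotient_sphere_bounds(2)[OF assms(1) x] unfolding K_def by linarith
  qed
  then have "upper_mNJ_const n TYPE('a) \<le> K"
    unfolding upper_mNJ_const_def using u by (intro cSUP_least) auto
  also have "K < n"
    unfolding K_def using gap assms(1) by simp
  finally show "upper_mNJ_const n TYPE('a) < n" .
qed

section \<open>Tuples in \<open>l\<^sub>n\<^sup>2\<close>\<close>

text \<open>
  A stability version of the equality case of \<open>\<Sum>j. a\<^sub>j \<le> sqrt n\<close>: if the sum is almost \<open>sqrt n\<close>, then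
  the \<open>a\<^sub>j\<close> are almost equal to \<open>1 / sqrt n\<close>, in the mean.
\<close>

lemma sum_abs_diff_inverse_sqrt_le:
  fixes a :: "nat \<Rightarrow> real"
  assumes "n \<ge> 1" and "L2_set a {1..n} \<le> 1"
  shows "(\<Sum>j=1..n. \<bar>a j - 1 / sqrt n\<bar>) \<le> sqrt n * sqrt (2 * (1 - (\<Sum>j=1..n. a j) / sqrt n))"
proof -
  let ?c = "1 / sqrt n"
  have n: "sqrt n > 0"
    using assms(1) by auto
  have squares: "(\<Sum>j=1..n. (a j)\<^sup>2) \<le> 1"
    using assms(2) by (simp add: L2_set_def sum_nonneg)
  have "(\<Sum>j=1..n. (a j - ?c)\<^sup>2) = (\<Sum>j=1..n. (a j)\<^sup>2 - 2 / sqrt n * a j + 1 / n)"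
    using assms(1) by (intro sum.cong) (auto simp: power2_diff power_divide)
  also have "\<dots> = (\<Sum>j=1..n. (a j)\<^sup>2) - 2 / sqrt n * (\<Sum>j=1..n. a j) + 1"
    using assms(1) by (simp add: sum.distrib sum_subtractf sum_distrib_left)
  also have "\<dots> \<le> 2 * (1 - (\<Sum>j=1..n. a j) / sqrt n)"
    using squares by simp
  finally have "L2_set (\<lambda>j. a j - ?c) {1..n} \<le> sqrt (2 * (1 - (\<Sum>j=1..n. a j) / sqrt n))"
    unfolding L2_set_def by simp
  then have "sqrt n * L2_set (\<lambda>j. a j - ?c) {1..n}
      \<le> sqrt n * sqrt (2 * (1 - (\<Sum>j=1..n. a j) / sqrt n))"
    using n by (intro mult_left_mono) auto
  moreover have "(\<Sum>j=1..n. \<bar>a j - ?c\<bar>) \<le> sqrt n * L2_set (\<lambda>j. a j - ?c) {1..n}"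
    using L2_set_mult_ineq[of "\<lambda>j. 1" "\<lambda>j. a j - ?c" "{1..n}"] by (simp add: L2_set_def)
  ultimately show ?thesis by (rule order_trans[rotated])
qed

text \<open>
  With \<open>\<mu>\<close> the minimal norm for \<open>x\<close> divided by \<open>sqrt n\<close>, normalization with \<open>c = 1 / sqrt n\<close> and the
  stability estimate give \<open>\<mu> \<le> (1 - \<delta>) + sqrt (2 * (1 - \<mu>))\<close>. The constant \<open>\<delta>\<^sup>2 / 8\<close> is chosen so
  that \<open>1 - \<mu> < \<delta>\<^sup>2 / 8\<close> bounds the square root by \<open>\<delta> / 2\<close>; this would give \<open>\<mu> \<le> 1 - \<delta> / 2\<close>,
  which is impossible for \<open>\<delta> \<le> 1\<close>.
\<close>

lemma l2n_ball_gap_if_sphere: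
  fixes x :: "nat \<Rightarrow> 'a::real_normed_vector"
  assumes "n \<ge> 1" and "\<exists>v::'a. v \<noteq> 0"
    and \<delta>: "0 < \<delta>" "\<delta> \<le> 1" and sphere: "non_l1n_on_sphere n \<delta> TYPE('a)"
    and x: "x \<in> l2n_unit_ball n"
  shows "min_signed_norm n x \<le> sqrt n * (1 - \<delta>\<^sup>2 / 8)"
proof (rule ccontr)
  define \<mu> where "\<mu> = min_signed_norm n x / sqrt n"
  have n: "sqrt n > 0" "n / sqrt n = sqrt n"
    using assms(1) by (auto simp: real_div_sqrt)
  assume "\<not> ?thesis"
  then have large: "1 - \<mu> < \<delta>\<^sup>2 / 8"
    using n(1) by (simp add: \<mu>_def field_simps)
  obtain y where y: "y \<in> {1..n} \<rightarrow>\<^sub>E sphere (0::'a) 1"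
    "min_signed_norm n x \<le> 1 / sqrt n * min_signed_norm n y + (\<Sum>j=1..n. \<bar>norm (x j) - 1 / sqrt n\<bar>)"
    using normalize_tuple[OF assms(1,2), of "1 / sqrt n" x] by auto
  have "(\<Sum>j=1..n. \<bar>norm (x j) - 1 / sqrt n\<bar>)
      \<le> sqrt n * sqrt (2 * (1 - (\<Sum>j=1..n. norm (x j)) / sqrt n))"
    using x by (intro sum_abs_diff_inverse_sqrt_le[OF assms(1)])
      (auto simp: l2n_unit_ball_def l2n_norm_def)
  also have "\<dots> \<le> sqrt n * sqrt (2 * (1 - \<mu>))"
    using min_signed_norm_le_sum_norm[OF assms(1), of x] n(1)
    by (simp add: \<mu>_def divide_right_mono)
  also have "\<dots> \<le> sqrt n * (\<delta> / 2)"
    using large \<delta>(1) by (intro mult_left_mono real_le_lsqrt) (auto simp: power_divide)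
  finally have err: "(\<Sum>j=1..n. \<bar>norm (x j) - 1 / sqrt n\<bar>) \<le> sqrt n * (\<delta> / 2)" .
  have "min_signed_norm n y \<le> n * (1 - \<delta>)"
    using sphere y(1) unfolding non_l1n_on_sphere_def by blast
  then have "1 / sqrt n * min_signed_norm n y \<le> 1 / sqrt n * (n * (1 - \<delta>))"
    using n(1) by (intro mult_left_mono) auto
  also have "\<dots> = sqrt n * (1 - \<delta>)"
    using n(2) by (metis mult.left_neutral times_divide_eq_left)
  finally have "min_signed_norm n x \<le> sqrt n * (1 - \<delta> / 2)"
    using y(2) err by (simp add: algebra_simps)
  then have "\<mu> \<le> 1 - \<delta> / 2"
    using n(1) by (simp add: \<mu>_def field_simps)
  moreover have "\<delta>\<^sup>2 / 8 < \<delta> / 2"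
    using \<delta> by (simp add: power2_eq_square)
  ultimately show False using large by linarith
qed

lemma non_l1n_on_sphere_if_l2n_sphere_gap:
  assumes "n \<ge> 1"
    and gap: "\<And>x::nat \<Rightarrow> 'a::real_normed_vector.
      x \<in> l2n_unit_sphere n \<Longrightarrow> min_signed_norm n x \<le> sqrt n * (1 - \<delta>)"
  shows "non_l1n_on_sphere n \<delta> TYPE('a)"
  unfolding non_l1n_on_sphere_def
proof
  fix x assume x: "x \<in> {1..n} \<rightarrow>\<^sub>E sphere (0::'a) 1"
  let ?y = "\<lambda>j. (1 / sqrt n) *\<^sub>R x j"
  have n: "sqrt n > 0" "sqrt n * sqrt n = n"
    using assms(1) by auto
  have "norm (x j) = 1" if "j \<in> {1..n}" for j
    using PiE_mem[OF x that] by simp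
  then have "restrict ?y {1..n} \<in> l2n_unit_sphere n"
    using assms(1) by (auto simp: l2n_unit_sphere_def l2n_norm_def L2_set_def power_divide)
  then have "min_signed_norm n (restrict ?y {1..n}) \<le> sqrt n * (1 - \<delta>)"
    by (rule gap)
  also have "min_signed_norm n (restrict ?y {1..n}) = min_signed_norm n ?y"
    using assms(1) by (intro min_signed_norm_cong) auto
  also have "\<dots> = min_signed_norm n x / sqrt n"
    using min_signed_norm_scaleR[of "1 / sqrt n" n x] by simp
  finally have "min_signed_norm n x \<le> sqrt n * (1 - \<delta>) * sqrt n"
    using n(1) by (simp add: pos_divide_le_eq)
  also have "\<dots> = n * (1 - \<delta>)"
    using n(2) by (metis mult.assoc mult.commute)
  finally show "min_signed_norm n x \<le> n * (1 - \<delta>)" .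
qed

section \<open>The equivalences\<close>

theorem theorem7:
  fixes n :: nat
  assumes "n \<ge> 2"
    and "\<exists>v::'a::banach. v \<noteq> 0"
  shows "(upper_mNJ_const n TYPE('a) < real n \<longleftrightarrow> uniformly_non_l1n n TYPE('a)) \<and>
    (uniformly_non_l1n n TYPE('a) \<longleftrightarrow>
      (\<exists>\<delta>\<in>{0<..<1}. \<forall>x \<in> (l2n_unit_ball n :: (nat \<Rightarrow> 'a) set).
         min_signed_norm n x \<le> sqrt (real n) * (1 - \<delta>))) \<and>
    ((\<exists>\<delta>\<in>{0<..<1}. \<forall>x \<in> (l2n_unit_ball n :: (nat \<Rightarrow> 'a) set).
         min_signed_norm n x \<le> sqrt (real n) * (1 - \<delta>)) \<longleftrightarrow>
      (\<exists>\<delta>\<in>{0<..<1}. \<forall>x \<in> (l2n_unit_sphere n :: (nat \<Rightarrow> 'a) set).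
         min_signed_norm n x \<le> sqrt (real n) * (1 - \<delta>)))"
    (is "(?A \<longleftrightarrow> ?B) \<and> (?B \<longleftrightarrow> ?C) \<and> (?C \<longleftrightarrow> ?D)")
proof -
  let ?P = "\<exists>\<delta>>0. non_l1n_on_sphere n \<delta> TYPE('a)"
  have n: "n \<ge> 1" using assms(1) by simp
  have A: "?A \<longleftrightarrow> ?P" using upper_mNJ_const_less_iff_sphere[OF n assms(2)] .
  have B: "?B \<longleftrightarrow> ?P" using uniformly_non_l1n_iff_sphere[OF n assms(2)] .
  have C: ?C if sphere: ?P
  proof -
    obtain \<delta>\<^sub>0 where \<delta>\<^sub>0: "\<delta>\<^sub>0 > 0" "non_l1n_on_sphere n \<delta>\<^sub>0 TYPE('a)"
      using sphere by blast
    \<comment> \<open>The condition on unit vectors gets weaker as its constant decreases.\<close>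
    define \<delta> where "\<delta> = min \<delta>\<^sub>0 1"
    have \<delta>: "0 < \<delta>" "\<delta> \<le> 1" "\<delta> \<le> \<delta>\<^sub>0"
      using \<delta>\<^sub>0(1) by (auto simp: \<delta>_def)
    have "real n * (1 - \<delta>\<^sub>0) \<le> real n * (1 - \<delta>)"
      using \<delta>(3) by (intro mult_left_mono) auto
    then have "non_l1n_on_sphere n \<delta> TYPE('a)"
      using \<delta>\<^sub>0(2) unfolding non_l1n_on_sphere_def by (meson order_trans)
    then have "\<forall>x \<in> (l2n_unit_ball n :: (nat \<Rightarrow> 'a) set).
        min_signed_norm n x \<le> sqrt n * (1 - \<delta>\<^sup>2 / 8)"
      using l2n_ball_gap_if_sphere[OF n assms(2) \<delta>(1,2)] by blast
    moreover have "\<delta>\<^sup>2 \<le> 1"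
      using \<delta>(1,2) by (simp add: power_le_one)
    then have "\<delta>\<^sup>2 / 8 \<in> {0<..<1}"
      using \<delta>(1) by simp
    ultimately show ?C by blast
  qed
  have D: ?D if ball: ?C
  proof -
    have "(l2n_unit_sphere n :: (nat \<Rightarrow> 'a) set) \<subseteq> l2n_unit_ball n"
      by (auto simp: l2n_unit_sphere_def l2n_unit_ball_def)
    then show ?D using ball by blast
  qed
  have P: ?P if gap: ?D
  proof -
    obtain \<delta> where "\<delta> \<in> {0<..<1}" and "\<forall>x \<in> (l2n_unit_sphere n :: (nat \<Rightarrow> 'a) set).
        min_signed_norm n x \<le> sqrt n * (1 - \<delta>)"
      using gap by blast
    then show ?P
      using non_l1n_on_sphere_if_l2n_sphere_gap[OF n, of \<delta>] by (intro exI[of _ \<delta>]) auto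
  qed
  have "?C \<longleftrightarrow> ?P" and "?D \<longleftrightarrow> ?P"
    using C D P by iprover+
  with A B show ?thesis by simp
qed

end
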